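(* Let $n\ge 2$ and $m\ge 1$ be integers, let $A$ be an $m\times m$ matrix over $\mathbb{Z}_n$, let $f:\mathbb{Z}_n^m\to\mathbb{Z}_n^m$ be the linear map $f(x)=Ax$, and let $s$ be the system height of $(\mathbb{Z}_n^m,f)$. If $n=p_1^{e_1}p_2^{e_2}\cdots p_\omega^{e_\omega}$ is the prime factorization of $n$ (with $p_1,\dots,p_\omega$ distinct primes and each $e_i\ge 1$), then $$s\le\max\{s_1e_1,\,s_2e_2,\,\dots,\,s_\omega e_\omega\},$$ where, for $i=1,2,\dots,\omega$, $s_i$ is the system height of the reduced system $(\mathbb{Z}_{p_i}^m,\,A \bmod p_i)$.
   Context: $\mathbb{Z}_n$ denotes the ring of integers modulo $n$. A finite dynamical system is a pair $(X,f)$ with $X$ a finite set and $f:X\to X$ a function. An element $x_0\in X$ is a cycle vertex if $f^l(x_0)=x_0$ for some positive integer $l$. The height $h(x)$ of $x\in X$ is the number of iterations it takes for $x$ to reach a cycle vertex, i.e. the smallest integer $k\ge 0$ such that $f^k(x)$ is a cycle vertex. The system height (or height) of $(X,f)$ is $\max_{x\in X}h(x)$. For a divisor $d$ of $n$, $A\bmod d$ is the matrix over $\mathbb{Z}_d$ obtained by reducing the entries of $A$ modulo $d$, and $(\mathbb{Z}_d^m,A\bmod d)$ is the finite dynamical system on $\mathbb{Z}_d^m$ given by the map $x\mapsto (A\bmod d)x$. *)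

theory Defs
  imports "Jordan_Normal_Form.Matrix" "HOL-Computational_Algebra.Primes"
begin

definition cycle_vertex :: "('a \<Rightarrow> 'a) \<Rightarrow> 'a \<Rightarrow> bool" where
  "cycle_vertex f x \<longleftrightarrow> (\<exists>l>0. (f ^^ l) x = x)"

definition height :: "('a \<Rightarrow> 'a) \<Rightarrow> 'a \<Rightarrow> nat" where
  "height f x = (LEAST k. cycle_vertex f ((f ^^ k) x))"

text \<open>Meaningful for a finite nonempty \<open>X\<close> that \<open>f\<close> maps into itself.\<close>

definition system_height :: "'a set \<Rightarrow> ('a \<Rightarrow> 'a) \<Rightarrow> nat" where
  "system_height X f = Max (height f ` X)"

text \<open>
  The ring of integers modulo \<open>d\<close> is represented by the least residues \<open>{0..<d}\<close>,
  with the operations of \<^typ>\<open>int\<close> followed by reduction modulo \<open>d\<close>.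
\<close>

definition residue_vecs :: "int \<Rightarrow> nat \<Rightarrow> int vec set" where
  "residue_vecs d m = {x \<in> carrier_vec m. \<forall>i<m. x $ i \<in> {0..<d}}"

definition residue_mats :: "int \<Rightarrow> nat \<Rightarrow> int mat set" where
  "residue_mats d m = {A \<in> carrier_mat m m. \<forall>i<m. \<forall>j<m. A $$ (i, j) \<in> {0..<d}}"

definition reduce_mat :: "int mat \<Rightarrow> int \<Rightarrow> int mat" where
  "reduce_mat A d = map_mat (\<lambda>a. a mod d) A"

definition residue_map :: "int \<Rightarrow> int mat \<Rightarrow> int vec \<Rightarrow> int vec" where
  "residue_map d A x = map_vec (\<lambda>a. a mod d) (A *\<^sub>v x)"

lemma reduce_mat_in_residue_mats:
  assumes "A \<in> carrier_mat m m" "d > 0"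
  shows "reduce_mat A d \<in> residue_mats d m"
proof -
  have "dim_row A = m" "dim_col A = m"
    using assms(1) by simp_all
  then have "reduce_mat A d $$ (i, j) = A $$ (i, j) mod d" if "i < m" "j < m" for i j
    using that by (simp add: reduce_mat_def)
  moreover have "reduce_mat A d \<in> carrier_mat m m"
    using assms(1) by (simp add: reduce_mat_def)
  ultimately show ?thesis
    using assms(2) by (simp add: residue_mats_def)
qed

lemma residue_map_closed:
  assumes "A \<in> carrier_mat m m" "d > 0"
  shows "residue_map d A x \<in> residue_vecs d m"
proof -
  have dim: "dim_vec (A *\<^sub>v x) = m"
    using assms(1) by simp
  have "residue_map d A x \<in> carrier_vec m"
    by (rule carrier_vecI) (simp only: residue_map_def index_map_vec dim)
  moreover have "residue_map d A x $ i = (A *\<^sub>v x) $ i mod d" if "i < m" for i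
    unfolding residue_map_def by (rule index_map_vec(1)) (simp only: dim that)
  ultimately show ?thesis
    using assms(2) by (simp add: residue_vecs_def)
qed

lemma residue_vecs_nonempty:
  assumes "d > 0"
  shows "residue_vecs d m \<noteq> {}"
proof -
  have "0\<^sub>v m \<in> residue_vecs d m"
    using assms by (auto simp: residue_vecs_def)
  then show ?thesis by blast
qed

lemma finite_residue_vecs: "finite (residue_vecs d m)"
proof (rule finite_subset)
  let ?L = "{xs. set xs \<subseteq> {0..<d} \<and> length xs = m}"
  show "finite (vec_of_list ` ?L)"
    by (rule finite_imageI, rule finite_lists_length_eq) simp
  show "residue_vecs d m \<subseteq> vec_of_list ` ?L"
  proof
    fix x assume "x \<in> residue_vecs d m"
    then have "list_of_vec x \<in> ?L"
      by (auto simp: residue_vecs_def list_of_vec_map)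
    then have "vec_of_list (list_of_vec x) \<in> vec_of_list ` ?L"
      by (rule imageI)
    then show "x \<in> vec_of_list ` ?L"
      by (simp only: vec_list)
  qed
qed

end

theory Submission imports Defs begin

text \<open>
  A point of a finite system is a cycle vertex exactly when it lies in the image of every iterate
  of the map (\<open>cycle_vertex_iff_in_all_images\<close>). So the linear system over \<open>\<int>\<^sub>d\<close> has height at most \<open>k\<close>
  if and only if \<open>A\<^sup>k \<int>\<^sup>m \<subseteq> A\<^sup>j \<int>\<^sup>m + d \<int>\<^sup>m\<close> for every \<open>j\<close> (\<open>system_height_le_iff_image_stable\<close>),
  a condition on submodules of \<open>\<int>\<^sup>m\<close> in which the modulus can be varied freely.

  If it holds with exponent \<open>k\<close> for \<open>c\<close> and with exponent \<open>l\<close> for \<open>d\<close>, then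
  \<open>A\<^sup>k\<^sup>+\<^sup>l \<int>\<^sup>m \<subseteq> A\<^sup>k (A\<^sup>j \<int>\<^sup>m + d \<int>\<^sup>m) \<subseteq> A\<^sup>j \<int>\<^sup>m + d A\<^sup>k \<int>\<^sup>m \<subseteq> A\<^sup>j \<int>\<^sup>m + c d \<int>\<^sup>m\<close>,
  so exponents add when moduli multiply (\<open>image_stable_mult\<close>). Hence height \<open>s\<^sub>i\<close> modulo \<open>p\<^sub>i\<close> gives
  height at most \<open>s\<^sub>i e\<^sub>i\<close> modulo the \<open>e\<^sub>i\<close>-th power of \<open>p\<^sub>i\<close>. For coprime moduli a common exponent
  survives multiplication (\<open>image_stable_coprime_mult\<close>), and the largest of the \<open>s\<^sub>i e\<^sub>i\<close> is such a
  common exponent for the prime powers that make up \<open>n\<close>.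
\<close>

section \<open>Height of a finite dynamical system\<close>

lemma cycle_vertex_funpow:
  assumes "cycle_vertex f x"
  shows "cycle_vertex f ((f ^^ k) x)"
proof -
  from assms obtain l where "l > 0" "(f ^^ l) x = x"
    by (auto simp: cycle_vertex_def)
  moreover have "(f ^^ l) ((f ^^ k) x) = (f ^^ k) ((f ^^ l) x)"
    by (metis add.commute comp_apply funpow_add)
  ultimately show ?thesis
    unfolding cycle_vertex_def by metis
qed

lemma funpow_closed:
  assumes "f \<in> X \<rightarrow> X" "x \<in> X"
  shows "(f ^^ k) x \<in> X"
  using assms by (induction k) auto

text \<open>By the pigeonhole principle an orbit in a finite set repeats a value.\<close>

lemma eventually_cycle_vertex:
  assumes "finite X" "f \<in> X \<rightarrow> X" "x \<in> X"
  shows "\<exists>k. cycle_vertex f ((f ^^ k) x)"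
proof -
  have "range (\<lambda>k. (f ^^ k) x) \<subseteq> X"
    using funpow_closed[OF assms(2,3)] by auto
  then have "\<not> inj (\<lambda>k. (f ^^ k) x)"
    using assms(1) finite_imageD finite_subset infinite_UNIV_nat by metis
  then obtain a b where "a < b" "(f ^^ a) x = (f ^^ b) x"
    unfolding inj_on_def by (metis linorder_neqE_nat)
  then have "(f ^^ (b - a)) ((f ^^ a) x) = (f ^^ a) x"
    by (metis comp_apply funpow_add le_add_diff_inverse2 less_imp_le)
  then show ?thesis
    using \<open>a < b\<close> unfolding cycle_vertex_def by (metis zero_less_diff)
qed

lemma height_le_iff:
  assumes "finite X" "f \<in> X \<rightarrow> X" "x \<in> X"
  shows "height f x \<le> k \<longleftrightarrow> cycle_vertex f ((f ^^ k) x)"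
proof
  assume le: "height f x \<le> k"
  have "cycle_vertex f ((f ^^ height f x) x)"
    unfolding height_def using eventually_cycle_vertex[OF assms] by (rule LeastI_ex)
  then have "cycle_vertex f ((f ^^ (k - height f x)) ((f ^^ height f x) x))"
    by (rule cycle_vertex_funpow)
  then show "cycle_vertex f ((f ^^ k) x)"
    using le by (metis comp_apply funpow_add le_add_diff_inverse2)
next
  assume "cycle_vertex f ((f ^^ k) x)"
  then show "height f x \<le> k"
    unfolding height_def by (rule Least_le)
qed

lemma system_height_le_iff_cycle_vertex:
  assumes "finite X" "X \<noteq> {}" "f \<in> X \<rightarrow> X"
  shows "system_height X f \<le> k \<longleftrightarrow> (\<forall>x\<in>X. cycle_vertex f ((f ^^ k) x))"
  using assms by (simp add: system_height_def height_le_iff)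

text \<open>
  A periodic point has preimages of every order on its own cycle. Conversely, once \<open>j\<close> reaches the
  height of the system, the image of the \<open>j\<close>-th iterate contains nothing but cycle vertices.
\<close>

lemma cycle_vertex_iff_in_all_images:
  assumes "finite X" "f \<in> X \<rightarrow> X" "x \<in> X"
  shows "cycle_vertex f x \<longleftrightarrow> (\<forall>j. x \<in> (f ^^ j) ` X)"
proof
  assume "cycle_vertex f x"
  then obtain l where l: "l > 0" "(f ^^ l) x = x"
    by (auto simp: cycle_vertex_def)
  show "\<forall>j. x \<in> (f ^^ j) ` X"
  proof
    fix j
    have "j \<le> l * j"
      using l(1) by simp
    have "(f ^^ (l * j)) x = x"
      using l(2) by (induction j) (simp_all add: funpow_add)
    then have "(f ^^ j) ((f ^^ (l * j - j)) x) = x"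
      using \<open>j \<le> l * j\<close> by (metis comp_apply funpow_add le_add_diff_inverse)
    then show "x \<in> (f ^^ j) ` X"
      using funpow_closed[OF assms(2,3)] by (metis imageI)
  qed
next
  assume "\<forall>j. x \<in> (f ^^ j) ` X"
  then obtain y where "y \<in> X" "x = (f ^^ system_height X f) y"
    by blast
  moreover have "X \<noteq> {}"
    using assms(3) by blast
  ultimately show "cycle_vertex f x"
    using system_height_le_iff_cycle_vertex[of X f "system_height X f"] assms(1,2) by blast
qed

lemma system_height_le_iff_in_all_images:
  assumes "finite X" "X \<noteq> {}" "f \<in> X \<rightarrow> X"
  shows "system_height X f \<le> k \<longleftrightarrow> (\<forall>x\<in>X. \<forall>j. (f ^^ k) x \<in> (f ^^ j) ` X)"
  using assms
  by (simp add: system_height_le_iff_cycle_vertex cycle_vertex_iff_in_all_images funpow_closed)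

section \<open>Stabilisation of the images of the powers of an integer matrix\<close>

text \<open>
  Modulo \<open>c\<close> the modules \<open>A\<^sup>j \<int>\<^sup>m\<close> form a decreasing chain, and the condition says that this chain is
  constant from exponent \<open>k\<close> on. Lifting it to integer vectors, with \<open>c z\<close> as an explicit error term,
  lets one compare different moduli without changing the vectors.
\<close>

definition image_stable :: "nat \<Rightarrow> int mat \<Rightarrow> nat \<Rightarrow> int \<Rightarrow> bool" where
  "image_stable m A k c \<longleftrightarrow>
     (\<forall>j. \<forall>x\<in>carrier_vec m. \<exists>y\<in>carrier_vec m. \<exists>z\<in>carrier_vec m.
        (A ^\<^sub>m k) *\<^sub>v x = (A ^\<^sub>m j) *\<^sub>v y + c \<cdot>\<^sub>v z)"

lemma image_stableE:
  assumes "image_stable m A k c" "x \<in> carrier_vec m"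
  obtains y z where "y \<in> carrier_vec m" "z \<in> carrier_vec m"
    "(A ^\<^sub>m k) *\<^sub>v x = (A ^\<^sub>m j) *\<^sub>v y + c \<cdot>\<^sub>v z"
  using assms unfolding image_stable_def by blast

lemma mult_mat_smult_vec:
  fixes A :: "'a :: comm_ring_1 mat"
  assumes "A \<in> carrier_mat nr nc" "v \<in> carrier_vec nc"
  shows "A *\<^sub>v (k \<cdot>\<^sub>v v) = k \<cdot>\<^sub>v (A *\<^sub>v v)"
  using assms by (intro eq_vecI) auto

lemma pow_mat_add_mult_vec:
  assumes "A \<in> carrier_mat m m" "x \<in> carrier_vec m"
  shows "(A ^\<^sub>m (k + l)) *\<^sub>v x = (A ^\<^sub>m k) *\<^sub>v ((A ^\<^sub>m l) *\<^sub>v x)"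
  using assms
proof (induction l arbitrary: x)
  case 0
  then show ?case by simp
next
  case (Suc l)
  have "(A ^\<^sub>m (k + Suc l)) *\<^sub>v x = (A ^\<^sub>m (k + l)) *\<^sub>v (A *\<^sub>v x)"
    using Suc.prems by (simp add: assoc_mult_mat_vec[of _ m m _ m])
  also have "\<dots> = (A ^\<^sub>m k) *\<^sub>v ((A ^\<^sub>m l) *\<^sub>v (A *\<^sub>v x))"
    using Suc by simp
  also have "\<dots> = (A ^\<^sub>m k) *\<^sub>v ((A ^\<^sub>m Suc l) *\<^sub>v x)"
    using Suc.prems by (simp add: assoc_mult_mat_vec[of _ m m _ m])
  finally show ?case .
qed

lemma image_stable_mono:
  assumes "A \<in> carrier_mat m m" "image_stable m A k c" "k \<le> l"
  shows "image_stable m A l c"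
  unfolding image_stable_def
proof (intro allI ballI)
  fix j and x :: "int vec"
  assume x: "x \<in> carrier_vec m"
  have "(A ^\<^sub>m l) *\<^sub>v x = (A ^\<^sub>m k) *\<^sub>v ((A ^\<^sub>m (l - k)) *\<^sub>v x)"
    using pow_mat_add_mult_vec[OF assms(1) x, of k "l - k"] assms(3) by simp
  moreover have "(A ^\<^sub>m (l - k)) *\<^sub>v x \<in> carrier_vec m"
    using assms(1) x by (meson mult_mat_vec_carrier pow_carrier_mat)
  ultimately show "\<exists>y\<in>carrier_vec m. \<exists>z\<in>carrier_vec m.
      (A ^\<^sub>m l) *\<^sub>v x = (A ^\<^sub>m j) *\<^sub>v y + c \<cdot>\<^sub>v z"
    using assms(2) unfolding image_stable_def by simp
qed

text \<open>
  The error term \<open>d z\<close> present after \<open>l\<close> steps is itself multiplied by \<open>A\<^sup>k\<close> in the remaining \<open>k\<close>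
  steps. The hypothesis on \<open>c\<close>, applied to \<open>z\<close>, moves it into \<open>A\<^sup>j \<int>\<^sup>m\<close> up to an error in \<open>c d \<int>\<^sup>m\<close>.
\<close>

lemma image_stable_mult:
  assumes A: "A \<in> carrier_mat m m"
    and c: "image_stable m A k c" and d: "image_stable m A l d"
  shows "image_stable m A (k + l) (c * d)"
  unfolding image_stable_def
proof (intro allI ballI)
  fix j and x :: "int vec"
  assume x: "x \<in> carrier_vec m"
  have P: "A ^\<^sub>m i \<in> carrier_mat m m" for i
    using A by simp
  note V = mult_mat_vec_carrier[OF P]
  obtain y z where y: "y \<in> carrier_vec m" and z: "z \<in> carrier_vec m"
    and yz: "(A ^\<^sub>m l) *\<^sub>v x = (A ^\<^sub>m j) *\<^sub>v y + d \<cdot>\<^sub>v z"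
    using image_stableE[OF d x] .
  obtain y' z' where y': "y' \<in> carrier_vec m" and z': "z' \<in> carrier_vec m"
    and yz': "(A ^\<^sub>m k) *\<^sub>v z = (A ^\<^sub>m j) *\<^sub>v y' + c \<cdot>\<^sub>v z'"
    using image_stableE[OF c z] .
  have comm: "(A ^\<^sub>m k) *\<^sub>v ((A ^\<^sub>m j) *\<^sub>v y) = (A ^\<^sub>m j) *\<^sub>v ((A ^\<^sub>m k) *\<^sub>v y)"
    using pow_mat_add_mult_vec[OF A y] by (metis add.commute)
  have "(A ^\<^sub>m (k + l)) *\<^sub>v x = (A ^\<^sub>m k) *\<^sub>v ((A ^\<^sub>m j) *\<^sub>v y + d \<cdot>\<^sub>v z)"
    using pow_mat_add_mult_vec[OF A x] yz by simp
  also have "\<dots> = (A ^\<^sub>m j) *\<^sub>v ((A ^\<^sub>m k) *\<^sub>v y) + d \<cdot>\<^sub>v ((A ^\<^sub>m k) *\<^sub>v z)"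
    using mult_add_distrib_mat_vec[OF P V[OF y] smult_carrier_vec[THEN iffD2, OF z]]
      mult_mat_smult_vec[OF P z] comm by simp
  also have "\<dots> = (A ^\<^sub>m j) *\<^sub>v ((A ^\<^sub>m k) *\<^sub>v y) + (d \<cdot>\<^sub>v ((A ^\<^sub>m j) *\<^sub>v y') + (c * d) \<cdot>\<^sub>v z')"
    using smult_add_distrib_vec[OF V[OF y'] smult_carrier_vec[THEN iffD2, OF z']] yz'
    by (simp add: smult_smult_assoc mult.commute)
  also have "\<dots> = (A ^\<^sub>m j) *\<^sub>v ((A ^\<^sub>m k) *\<^sub>v y + d \<cdot>\<^sub>v y') + (c * d) \<cdot>\<^sub>v z'"
    using mult_add_distrib_mat_vec[OF P V[OF y] smult_carrier_vec[THEN iffD2, OF y']]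
      mult_mat_smult_vec[OF P y'] V[OF V[OF y]] V[OF y'] z'
    by (simp add: assoc_add_vec[where n = m])
  finally have "(A ^\<^sub>m (k + l)) *\<^sub>v x
      = (A ^\<^sub>m j) *\<^sub>v ((A ^\<^sub>m k) *\<^sub>v y + d \<cdot>\<^sub>v y') + (c * d) \<cdot>\<^sub>v z'" .
  moreover have "(A ^\<^sub>m k) *\<^sub>v y + d \<cdot>\<^sub>v y' \<in> carrier_vec m"
    using V[OF y] y' by simp
  ultimately show "\<exists>y\<in>carrier_vec m. \<exists>z\<in>carrier_vec m.
      (A ^\<^sub>m (k + l)) *\<^sub>v x = (A ^\<^sub>m j) *\<^sub>v y + (c * d) \<cdot>\<^sub>v z"
    using z' by blast
qed

lemma image_stable_one:
  assumes "A \<in> carrier_mat m m"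
  shows "image_stable m A k 1"
proof -
  have "(A ^\<^sub>m k) *\<^sub>v x = (A ^\<^sub>m j) *\<^sub>v 0\<^sub>v m + 1 \<cdot>\<^sub>v ((A ^\<^sub>m k) *\<^sub>v x)" "(A ^\<^sub>m k) *\<^sub>v x \<in> carrier_vec m"
    if "x \<in> carrier_vec m" for j and x :: "int vec"
  proof -
    show "(A ^\<^sub>m k) *\<^sub>v x \<in> carrier_vec m"
      using assms that by (meson mult_mat_vec_carrier pow_carrier_mat)
    moreover have "(A ^\<^sub>m j) *\<^sub>v 0\<^sub>v m = 0\<^sub>v m"
      using assms by (intro eq_vecI) auto
    ultimately show "(A ^\<^sub>m k) *\<^sub>v x = (A ^\<^sub>m j) *\<^sub>v 0\<^sub>v m + 1 \<cdot>\<^sub>v ((A ^\<^sub>m k) *\<^sub>v x)"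
      by simp
  qed
  then show ?thesis
    unfolding image_stable_def by (meson zero_carrier_vec)
qed

lemma image_stable_power:
  assumes "A \<in> carrier_mat m m" "image_stable m A k c"
  shows "image_stable m A (k * e) (c ^ e)"
proof (induction e)
  case 0
  then show ?case
    using image_stable_one[OF assms(1)] by simp
next
  case (Suc e)
  then show ?case
    using image_stable_mult[OF assms(1,2) Suc.IH] by (simp add: mult.commute)
qed

text \<open>
  If \<open>u c + v d = 1\<close>, then \<open>w = A\<^sup>k x\<close> equals \<open>u c w + v d w\<close>; substituting the representation of
  \<open>w\<close> modulo \<open>d\<close> in the first summand and the one modulo \<open>c\<close> in the second turns both error terms
  into multiples of \<open>c d\<close>.
\<close>

lemma image_stable_coprime_mult:
  assumes A: "A \<in> carrier_mat m m"
    and c: "image_stable m A k c" and d: "image_stable m A k d" and "coprime c d"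
  shows "image_stable m A k (c * d)"
  unfolding image_stable_def
proof (intro allI ballI)
  fix j and x :: "int vec"
  assume x: "x \<in> carrier_vec m"
  let ?B = "A ^\<^sub>m j" and ?w = "(A ^\<^sub>m k) *\<^sub>v x"
  have B: "?B \<in> carrier_mat m m"
    using A by simp
  obtain u v where uv: "u * c + v * d = 1"
    using \<open>coprime c d\<close> by (metis bezout_int coprime_imp_gcd_eq_1)
  obtain y z where y: "y \<in> carrier_vec m" and z: "z \<in> carrier_vec m"
    and yz: "?w = ?B *\<^sub>v y + c \<cdot>\<^sub>v z"
    using image_stableE[OF c x] .
  obtain y' z' where y': "y' \<in> carrier_vec m" and z': "z' \<in> carrier_vec m"
    and yz': "?w = ?B *\<^sub>v y' + d \<cdot>\<^sub>v z'"
    using image_stableE[OF d x] .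
  let ?Y = "(v * d) \<cdot>\<^sub>v y + (u * c) \<cdot>\<^sub>v y'" and ?Z = "v \<cdot>\<^sub>v z + u \<cdot>\<^sub>v z'"
  have BY: "?B *\<^sub>v ?Y = (v * d) \<cdot>\<^sub>v (?B *\<^sub>v y) + (u * c) \<cdot>\<^sub>v (?B *\<^sub>v y')"
    using mult_add_distrib_mat_vec[OF B, of "(v * d) \<cdot>\<^sub>v y" "(u * c) \<cdot>\<^sub>v y'"] y y'
      mult_mat_smult_vec[OF B y] mult_mat_smult_vec[OF B y'] by simp
  have "?w = ?B *\<^sub>v ?Y + (c * d) \<cdot>\<^sub>v ?Z"
  proof (rule eq_vecI)
    show "dim_vec ?w = dim_vec (?B *\<^sub>v ?Y + (c * d) \<cdot>\<^sub>v ?Z)"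
      using z z' A by simp
    fix i
    assume "i < dim_vec (?B *\<^sub>v ?Y + (c * d) \<cdot>\<^sub>v ?Z)"
    then have i: "i < m"
      using z' by simp
    define a b where "a = (?B *\<^sub>v y) $ i" and "b = (?B *\<^sub>v y') $ i"
    have dims: "dim_vec (?B *\<^sub>v y) = m" "dim_vec (?B *\<^sub>v y') = m"
      using B by auto
    have 1: "?w $ i = a + c * z $ i"
      unfolding yz a_def using i z dims by (simp del: index_mult_mat_vec)
    have 2: "?w $ i = b + d * z' $ i"
      unfolding yz' b_def using i z' dims by (simp del: index_mult_mat_vec)
    have "(?B *\<^sub>v ?Y + (c * d) \<cdot>\<^sub>v ?Z) $ i
        = v * d * a + u * c * b + c * d * (v * z $ i + u * z' $ i)"
      unfolding BY a_def b_def using i z z' dims by (simp del: index_mult_mat_vec)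
    also have "\<dots> = v * d * (a + c * z $ i) + u * c * (b + d * z' $ i)"
      by (simp add: algebra_simps)
    also have "\<dots> = (u * c + v * d) * ?w $ i"
      unfolding 1[symmetric] 2[symmetric] by (simp add: algebra_simps)
    finally show "?w $ i = (?B *\<^sub>v ?Y + (c * d) \<cdot>\<^sub>v ?Z) $ i"
      using uv by simp
  qed
  moreover have "?Y \<in> carrier_vec m" "?Z \<in> carrier_vec m"
    using y y' z z' by simp_all
  ultimately show "\<exists>y\<in>carrier_vec m. \<exists>z\<in>carrier_vec m. ?w = ?B *\<^sub>v y + (c * d) \<cdot>\<^sub>v z"
    by blast
qed

lemma image_stable_prod:
  assumes "A \<in> carrier_mat m m" "finite I"
    and "\<And>i. i \<in> I \<Longrightarrow> image_stable m A k (q i)"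
    and "\<And>i j. i \<in> I \<Longrightarrow> j \<in> I \<Longrightarrow> i \<noteq> j \<Longrightarrow> coprime (q i) (q j)"
  shows "image_stable m A k (\<Prod>i\<in>I. q i)"
  using assms(2-)
proof (induction I rule: finite_induct)
  case empty
  then show ?case
    using image_stable_one[OF assms(1)] by simp
next
  case (insert a I)
  have "coprime (q a) (\<Prod>i\<in>I. q i)"
    using insert by (intro prod_coprime_right) auto
  then show ?case
    using insert image_stable_coprime_mult[OF assms(1)] by simp
qed

section \<open>Height of the linear systems over the residue rings\<close>

lemma map_vec_mod_eq_iff:
  fixes u v :: "int vec"
  assumes u: "u \<in> carrier_vec m" and v: "v \<in> carrier_vec m"
  shows "map_vec (\<lambda>a. a mod d) u = map_vec (\<lambda>a. a mod d) v
    \<longleftrightarrow> (\<exists>z\<in>carrier_vec m. u = v + d \<cdot>\<^sub>v z)"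
proof
  assume eq: "map_vec (\<lambda>a. a mod d) u = map_vec (\<lambda>a. a mod d) v"
  have "u $ i mod d = v $ i mod d" if "i < m" for i
    using arg_cong[OF eq, of "\<lambda>w. w $ i"] that u v by simp
  then have "u = v + d \<cdot>\<^sub>v vec m (\<lambda>i. (u $ i - v $ i) div d)"
    using u v by (intro eq_vecI) (auto simp: mod_eq_dvd_iff)
  then show "\<exists>z\<in>carrier_vec m. u = v + d \<cdot>\<^sub>v z"
    by (metis vec_carrier)
next
  assume "\<exists>z\<in>carrier_vec m. u = v + d \<cdot>\<^sub>v z"
  then show "map_vec (\<lambda>a. a mod d) u = map_vec (\<lambda>a. a mod d) v"
    using v by (auto intro!: eq_vecI)
qed

lemma sum_mod_cong:
  fixes f g :: "'a \<Rightarrow> int"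
  assumes "\<And>i. i \<in> S \<Longrightarrow> f i mod d = g i mod d"
  shows "sum f S mod d = sum g S mod d"
proof -
  have "(\<Sum>i\<in>S. f i mod d) = (\<Sum>i\<in>S. g i mod d)"
    using assms by (rule sum.cong[OF refl])
  then show ?thesis
    by (metis mod_sum_eq)
qed

lemma residue_map_mod:
  assumes "A \<in> carrier_mat m m" "x \<in> carrier_vec m"
  shows "residue_map d A (map_vec (\<lambda>a. a mod d) x) = residue_map d A x"
  using assms unfolding residue_map_def
  by (intro eq_vecI) (auto simp: scalar_prod_def mod_mult_left_eq mod_mult_right_eq intro!: sum_mod_cong)

lemma residue_map_reduce_mat:
  assumes "A \<in> carrier_mat m m" "x \<in> carrier_vec m"
  shows "residue_map d (reduce_mat A d) x = residue_map d A x"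
  using assms unfolding residue_map_def reduce_mat_def
  by (intro eq_vecI) (auto simp: scalar_prod_def mod_mult_left_eq mod_mult_right_eq intro!: sum_mod_cong)

lemma mod_residue_vec:
  assumes "x \<in> residue_vecs d m"
  shows "map_vec (\<lambda>a. a mod d) x = x"
  using assms by (intro eq_vecI) (auto simp: residue_vecs_def)

lemma funpow_residue_map:
  assumes A: "A \<in> carrier_mat m m" and "d > 0" "x \<in> residue_vecs d m"
  shows "(residue_map d A ^^ k) x = map_vec (\<lambda>a. a mod d) ((A ^\<^sub>m k) *\<^sub>v x)"
  using assms(3)
proof (induction k arbitrary: x)
  case 0
  then show ?case
    using A by (simp add: mod_residue_vec residue_vecs_def)
next
  case (Suc k)
  have x: "x \<in> carrier_vec m"
    using Suc.prems by (simp add: residue_vecs_def)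
  have "(residue_map d A ^^ Suc k) x = residue_map d (A ^\<^sub>m k) (residue_map d A x)"
    unfolding funpow_Suc_right comp_apply Suc.IH[OF residue_map_closed[OF A \<open>d > 0\<close>]]
    by (simp only: residue_map_def)
  also have "\<dots> = residue_map d (A ^\<^sub>m k) (A *\<^sub>v x)"
    using residue_map_mod[of "A ^\<^sub>m k" m "A *\<^sub>v x" d] A x
    by (simp add: residue_map_def)
  also have "\<dots> = map_vec (\<lambda>a. a mod d) ((A ^\<^sub>m Suc k) *\<^sub>v x)"
    using A x by (simp add: residue_map_def assoc_mult_mat_vec[of _ m m _ m])
  finally show ?case .
qed

lemma map_vec_mod_in_residue_vecs:
  assumes "x \<in> carrier_vec m" "d > 0"
  shows "map_vec (\<lambda>a. a mod d) x \<in> residue_vecs d m"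
  using assms by (auto simp: residue_vecs_def)

text \<open>
  The quantifiers over residue vectors may be replaced by quantifiers over all integer vectors,
  since \<open>A\<^sup>k x\<close> modulo \<open>d\<close> depends on \<open>x\<close> modulo \<open>d\<close> only.
\<close>

lemma system_height_le_iff_image_stable:
  assumes A: "A \<in> carrier_mat m m" and d: "d > 0"
  shows "system_height (residue_vecs d m) (residue_map d A) \<le> k \<longleftrightarrow> image_stable m A k d"
proof -
  let ?X = "residue_vecs d m" and ?f = "residue_map d A" and ?r = "map_vec (\<lambda>a. a mod d)"
  have P: "A ^\<^sub>m i \<in> carrier_mat m m" for i
    using A by simp
  have V: "(A ^\<^sub>m i) *\<^sub>v x \<in> carrier_vec m" if "x \<in> carrier_vec m" for i x
    using mult_mat_vec_carrier[OF P that] .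
  have X: "?X = ?r ` carrier_vec m"
  proof
    show "?X \<subseteq> ?r ` carrier_vec m"
    proof
      fix x
      assume x: "x \<in> ?X"
      then have "x \<in> carrier_vec m"
        by (simp add: residue_vecs_def)
      then show "x \<in> ?r ` carrier_vec m"
        using mod_residue_vec[OF x] by (metis imageI)
    qed
    show "?r ` carrier_vec m \<subseteq> ?X"
      using map_vec_mod_in_residue_vecs[OF _ d] by blast
  qed
  have pow: "(?f ^^ i) (?r x) = ?r ((A ^\<^sub>m i) *\<^sub>v x)" if "x \<in> carrier_vec m" for i x
    using funpow_residue_map[OF A d map_vec_mod_in_residue_vecs[OF that d]]
      residue_map_mod[OF P that] by (simp add: residue_map_def)
  have "system_height ?X ?f \<le> k \<longleftrightarrow> (\<forall>x\<in>?X. \<forall>j. (?f ^^ k) x \<in> (?f ^^ j) ` ?X)"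
    using residue_map_closed[OF A d]
    by (intro system_height_le_iff_in_all_images finite_residue_vecs residue_vecs_nonempty d) blast
  also have "\<dots> \<longleftrightarrow> (\<forall>x\<in>carrier_vec m. \<forall>j. \<exists>y\<in>carrier_vec m.
      ?r ((A ^\<^sub>m k) *\<^sub>v x) = ?r ((A ^\<^sub>m j) *\<^sub>v y))"
    unfolding X by (simp add: image_iff pow)
  also have "\<dots> \<longleftrightarrow> image_stable m A k d"
    unfolding image_stable_def using map_vec_mod_eq_iff[OF V V] by simp blast
  finally show ?thesis .
qed

lemma system_height_cong:
  assumes "f \<in> X \<rightarrow> X" "\<And>x. x \<in> X \<Longrightarrow> f x = g x"
  shows "system_height X f = system_height X g"
proof -
  have pow: "(f ^^ k) x = (g ^^ k) x" if "x \<in> X" for k x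
    using that by (induction k) (simp_all, metis assms funpow_closed)
  have "cycle_vertex f ((f ^^ k) x) = cycle_vertex g ((g ^^ k) x)" if "x \<in> X" for k x
    using that pow funpow_closed[OF assms(1) that, of k] by (simp add: cycle_vertex_def)
  then show ?thesis
    by (simp add: system_height_def height_def cong: image_cong)
qed

lemma system_height_reduce_mat:
  assumes "A \<in> carrier_mat m m" "d > 0"
  shows "system_height (residue_vecs d m) (residue_map d (reduce_mat A d))
    = system_height (residue_vecs d m) (residue_map d A)"
proof (rule system_height_cong[symmetric])
  show "residue_map d A \<in> residue_vecs d m \<rightarrow> residue_vecs d m"
    using residue_map_closed[OF assms] by blast
  show "residue_map d A x = residue_map d (reduce_mat A d) x" if "x \<in> residue_vecs d m" for x
    using residue_map_reduce_mat[OF assms(1)] that by (simp add: residue_vecs_def)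
qed

theorem theoremB:
  fixes n :: int and m :: nat and A :: "int mat"
    and \<omega> :: nat and p :: "nat \<Rightarrow> int" and e :: "nat \<Rightarrow> nat"
  assumes "n \<ge> 2" and "m \<ge> 1"
    and "A \<in> residue_mats n m"
    and "\<And>i. i \<in> {1..\<omega>} \<Longrightarrow> prime (p i)"
    and "inj_on p {1..\<omega>}"
    and "\<And>i. i \<in> {1..\<omega>} \<Longrightarrow> e i \<ge> 1"
    and "n = (\<Prod>i = 1..\<omega>. p i ^ e i)"
  shows "system_height (residue_vecs n m) (residue_map n A)
    \<le> Max ((\<lambda>i. system_height (residue_vecs (p i) m)
                 (residue_map (p i) (reduce_mat A (p i))) * e i) ` {1..\<omega>})"
proof -
  let ?s = "\<lambda>i. system_height (residue_vecs (p i) m) (residue_map (p i) (reduce_mat A (p i)))"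
  let ?k = "Max ((\<lambda>i. ?s i * e i) ` {1..\<omega>})"
  have A: "A \<in> carrier_mat m m"
    using assms(3) by (simp add: residue_mats_def)
  have "image_stable m A ?k (p i ^ e i)" if i: "i \<in> {1..\<omega>}" for i
  proof -
    have pos: "p i > 0"
      using assms(4)[OF i] by (rule prime_gt_0_int)
    have "image_stable m A (?s i) (p i)"
      using system_height_le_iff_image_stable[OF A pos, of "?s i"] system_height_reduce_mat[OF A pos]
      by simp
    then have "image_stable m A (?s i * e i) (p i ^ e i)"
      by (rule image_stable_power[OF A])
    moreover have "?s i * e i \<le> ?k"
      using i by (intro Max_ge) auto
    ultimately show ?thesis
      by (rule image_stable_mono[OF A])
  qed
  moreover have "coprime (p i ^ e i) (p j ^ e j)"
    if "i \<in> {1..\<omega>}" "j \<in> {1..\<omega>}" "i \<noteq> j" for i j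
    using that assms(4) inj_onD[OF assms(5)] primes_coprime[of "p i" "p j"]
    by (metis coprime_power_left_iff coprime_power_right_iff)
  ultimately have "image_stable m A ?k n"
    unfolding assms(7) by (intro image_stable_prod[OF A]) auto
  then show ?thesis
    using system_height_le_iff_image_stable[OF A] assms(1) by simp
qed

end
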